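(* Let $q:E_{int}\to i\mathbb{R}$ be a discrete holomorphic quadratic differential on a realization $z:V\to\mathbb{C}$ of a triangular mesh. Suppose $\Phi:\overline{\mathbb{C}}\to\overline{\mathbb{C}}$ is a Möbius transformation such that $\Phi(z_i)\neq\infty$ for every vertex $i$. Then $q$ is again a discrete holomorphic quadratic differential on $w:=\Phi\circ z$, i.e. for every interior vertex $i$ one has $\sum_j q_{ij}=0$ and $\sum_j q_{ij}/(w_j-w_i)=0$ (sums over all vertices $j$ adjacent to $i$).
   Context: A triangular mesh is an oriented simplicial complex whose underlying topological space is a connected 2-manifold (possibly with boundary); $V,E,F$ are its sets of vertices, edges and triangles, $V_{int}$ and $E_{int}$ its sets of interior vertices and interior edges. A realization is a map $z:V\to\mathbb{C}$ such that for each triangle $\{ijk\}\in F$ the points $z_i,z_j,z_k$ are not collinear. $\overline{\mathbb{C}}=\mathbb{C}\cup\{\infty\}$. A function $q:E_{int}\to i\mathbb{R}$ (purely imaginary values, $q_{ij}=q_{ji}$) is a discrete holomorphic quadratic differential on $z$ if for every interior vertex $i\in V_{int}$: $\sum_j q_{ij}=0$ and $\sum_j q_{ij}/(z_j-z_i)=0$, where the sums are over all vertices $j$ adjacent to $i$. (These conditions only require $z_i\ne z_j$ along edges.) *)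

theory Defs
  imports "HOL-Analysis.Analysis"
begin

section \<open>Abstract simplicial complexes and their underlying spaces\<close>

definition abstract_simplicial_complex :: "'v set set \<Rightarrow> bool" where
  "abstract_simplicial_complex K \<longleftrightarrow>
     (\<forall>\<sigma>\<in>K. finite \<sigma> \<and> \<sigma> \<noteq> {} \<and> (\<forall>\<tau>. \<tau> \<subseteq> \<sigma> \<and> \<tau> \<noteq> {} \<longrightarrow> \<tau> \<in> K))"

definition vertices :: "'v set set \<Rightarrow> 'v set" where
  "vertices K = \<Union>K"

definition edges :: "'v set set \<Rightarrow> 'v set set" where
  "edges K = {e \<in> K. card e = 2}"

definition triangles :: "'v set set \<Rightarrow> 'v set set" where
  "triangles K = {\<sigma> \<in> K. card \<sigma> = 3}"

definition neighbours :: "'v set set \<Rightarrow> 'v \<Rightarrow> 'v set" where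
  "neighbours K i = {j. {i, j} \<in> edges K}"

text \<open>The closed cell of a simplex, in barycentric coordinates.\<close>

definition cell :: "'v set \<Rightarrow> ('v \<Rightarrow> real) set" where
  "cell \<sigma> = {x. (\<forall>v. 0 \<le> x v) \<and> (\<forall>v. v \<notin> \<sigma> \<longrightarrow> x v = 0) \<and> (\<Sum>v\<in>\<sigma>. x v) = 1}"

definition vertex_point :: "'v \<Rightarrow> 'v \<Rightarrow> real" where
  "vertex_point v = (\<lambda>u. if u = v then 1 else 0)"

text \<open>
  The underlying space carries the weak topology determined by its cells. On each cell of a
  finite simplex, the product topology of the function space is the Euclidean topology.
\<close>

definition underlying_space :: "'v set set \<Rightarrow> ('v \<Rightarrow> real) topology" where
  "underlying_space K =
     topology (\<lambda>U. U \<subseteq> (\<Union>\<sigma>\<in>K. cell \<sigma>) \<and> (\<forall>\<sigma>\<in>K. openin (top_of_set (cell \<sigma>)) (U \<inter> cell \<sigma>)))"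

lemma openin_underlying_space:
  "openin (underlying_space K) U \<longleftrightarrow>
     U \<subseteq> (\<Union>\<sigma>\<in>K. cell \<sigma>) \<and> (\<forall>\<sigma>\<in>K. openin (top_of_set (cell \<sigma>)) (U \<inter> cell \<sigma>))"
proof -
  have "istopology (\<lambda>U. U \<subseteq> (\<Union>\<sigma>\<in>K. cell \<sigma>) \<and> (\<forall>\<sigma>\<in>K. openin (top_of_set (cell \<sigma>)) (U \<inter> cell \<sigma>)))"
    unfolding istopology_def
  proof (intro conjI allI impI ballI)
    fix S T \<sigma>
    assume S: "S \<subseteq> (\<Union>\<sigma>\<in>K. cell \<sigma>) \<and> (\<forall>\<sigma>\<in>K. openin (top_of_set (cell \<sigma>)) (S \<inter> cell \<sigma>))"
      and T: "T \<subseteq> (\<Union>\<sigma>\<in>K. cell \<sigma>) \<and> (\<forall>\<sigma>\<in>K. openin (top_of_set (cell \<sigma>)) (T \<inter> cell \<sigma>))"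
    show "S \<inter> T \<subseteq> (\<Union>\<sigma>\<in>K. cell \<sigma>)" using S by blast
    assume "\<sigma> \<in> K"
    then have "openin (top_of_set (cell \<sigma>)) ((S \<inter> cell \<sigma>) \<inter> (T \<inter> cell \<sigma>))"
      using S T by blast
    moreover have "(S \<inter> cell \<sigma>) \<inter> (T \<inter> cell \<sigma>) = S \<inter> T \<inter> cell \<sigma>" by blast
    ultimately show "openin (top_of_set (cell \<sigma>)) (S \<inter> T \<inter> cell \<sigma>)" by simp
  next
    fix \<U>
    assume U: "\<forall>U\<in>\<U>. U \<subseteq> (\<Union>\<sigma>\<in>K. cell \<sigma>) \<and> (\<forall>\<sigma>\<in>K. openin (top_of_set (cell \<sigma>)) (U \<inter> cell \<sigma>))"
    show "\<Union>\<U> \<subseteq> (\<Union>\<sigma>\<in>K. cell \<sigma>)" using U by blast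
    fix \<sigma> assume "\<sigma> \<in> K"
    then have "openin (top_of_set (cell \<sigma>)) (\<Union>U\<in>\<U>. U \<inter> cell \<sigma>)"
      using U by blast
    moreover have "(\<Union>U\<in>\<U>. U \<inter> cell \<sigma>) = \<Union>\<U> \<inter> cell \<sigma>" by blast
    ultimately show "openin (top_of_set (cell \<sigma>)) (\<Union>\<U> \<inter> cell \<sigma>)" by simp
  qed
  then show ?thesis
    unfolding underlying_space_def by (simp add: topology_inverse')
qed


section \<open>Topological 2-manifolds with boundary\<close>

text \<open>The point \<open>x\<close> of \<open>X\<close> has an open neighbourhood homeomorphic to an open subset of \<open>M\<close>.\<close>

definition locally_modelled_at :: "'a topology \<Rightarrow> 'b topology \<Rightarrow> 'a \<Rightarrow> bool" where
  "locally_modelled_at X M x \<longleftrightarrow>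
     (\<exists>U W. openin X U \<and> x \<in> U \<and> openin M W \<and>
            subtopology X U homeomorphic_space subtopology M W)"

definition half_plane :: "(real \<times> real) set" where
  "half_plane = {p. 0 \<le> snd p}"

definition two_manifold_with_boundary :: "'a topology \<Rightarrow> bool" where
  "two_manifold_with_boundary X \<longleftrightarrow>
     Hausdorff_space X \<and> second_countable X \<and>
     (\<forall>x\<in>topspace X. locally_modelled_at X (top_of_set half_plane) x)"

definition manifold_interior :: "'a topology \<Rightarrow> 'a set" where
  "manifold_interior X =
     {x \<in> topspace X. locally_modelled_at X (euclidean :: (real \<times> real) topology) x}"

definition manifold_boundary :: "'a topology \<Rightarrow> 'a set" where
  "manifold_boundary X = topspace X - manifold_interior X"


section \<open>Triangular meshes and realizations\<close>

text \<open>
  \<open>P\<close> is the set of positively oriented triples: it picks one of the two cyclic orders of each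
  triangle. Coherence says that no directed edge is induced by two triangles, so that
  neighbouring triangles induce opposite directions on their common edge.
\<close>

definition coherent_orientation :: "'v set set \<Rightarrow> ('v \<times> 'v \<times> 'v) set \<Rightarrow> bool" where
  "coherent_orientation K P \<longleftrightarrow>
     (\<forall>i j k. (i, j, k) \<in> P \<longrightarrow> {i, j, k} \<in> triangles K \<and> (j, k, i) \<in> P) \<and>
     (\<forall>i j k. {i, j, k} \<in> triangles K \<longrightarrow> ((i, j, k) \<in> P \<longleftrightarrow> (i, k, j) \<notin> P)) \<and>
     (\<forall>i j k l. (i, j, k) \<in> P \<and> (i, j, l) \<in> P \<longrightarrow> k = l)"

definition triangular_mesh :: "'v set set \<Rightarrow> ('v \<times> 'v \<times> 'v) set \<Rightarrow> bool" where
  "triangular_mesh K P \<longleftrightarrow>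
     abstract_simplicial_complex K \<and>
     coherent_orientation K P \<and>
     two_manifold_with_boundary (underlying_space K) \<and>
     connected_space (underlying_space K)"

definition interior_vertices :: "'v set set \<Rightarrow> 'v set" where
  "interior_vertices K =
     {v \<in> vertices K. vertex_point v \<in> manifold_interior (underlying_space K)}"

text \<open>
  A boundary edge is one that lies in the boundary; an interior edge may still have one or both
  end points on the boundary.
\<close>

definition interior_edges :: "'v set set \<Rightarrow> 'v set set" where
  "interior_edges K = {e \<in> edges K. \<not> cell e \<subseteq> manifold_boundary (underlying_space K)}"

definition realization :: "'v set set \<Rightarrow> ('v \<Rightarrow> complex) \<Rightarrow> bool" where
  "realization K z \<longleftrightarrow> (\<forall>\<sigma>\<in>triangles K. \<not> collinear (z ` \<sigma>))"


section \<open>Discrete holomorphic quadratic differentials\<close>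

text \<open>
  A function on unoriented edges is a function \<open>q\<close> on two-element sets, so \<open>q\<^sub>i\<^sub>j = q\<^sub>j\<^sub>i\<close> holds
  by construction; only its values on interior edges are relevant, since all edges at an interior
  vertex are interior. The definition does not ask \<open>z\<close> to be a realization, because a Moebius
  transformation may make the vertices of a triangle collinear, but only that \<open>z\<close> separates the end
  points of each edge, so that no denominator vanishes (for a realization of a mesh this is automatic,
  since every edge of a triangulated surface lies in a triangle).
\<close>

definition discrete_holomorphic_quadratic_differential ::
    "'v set set \<Rightarrow> ('v \<Rightarrow> complex) \<Rightarrow> ('v set \<Rightarrow> complex) \<Rightarrow> bool" where
  "discrete_holomorphic_quadratic_differential K z q \<longleftrightarrow>
     (\<forall>i j. {i, j} \<in> edges K \<longrightarrow> z i \<noteq> z j) \<and>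
     (\<forall>e\<in>interior_edges K. Re (q e) = 0) \<and>
     (\<forall>i\<in>interior_vertices K.
        (\<Sum>j\<in>neighbours K i. q {i, j}) = 0 \<and>
        (\<Sum>j\<in>neighbours K i. q {i, j} / (z j - z i)) = 0)"


section \<open>Moebius transformations of the Riemann sphere\<close>

text \<open>The Riemann sphere is \<open>complex option\<close>, with \<open>None\<close> the point at infinity.\<close>

definition moebius :: "complex \<Rightarrow> complex \<Rightarrow> complex \<Rightarrow> complex \<Rightarrow> complex option \<Rightarrow> complex option" where
  "moebius a b c d x =
     (case x of
        None \<Rightarrow> if c = 0 then None else Some (a / c)
      | Some z \<Rightarrow> if c * z + d = 0 then None else Some ((a * z + b) / (c * z + d)))"

definition moebius_transformation :: "(complex option \<Rightarrow> complex option) \<Rightarrow> bool" where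
  "moebius_transformation \<Phi> \<longleftrightarrow> (\<exists>a b c d. a * d - b * c \<noteq> 0 \<and> \<Phi> = moebius a b c d)"

end

theory Submission
  imports Defs
begin

text \<open>
  With \<open>D = a d - b c\<close>, a Moebius transformation satisfies
  \<open>1 / (w\<^sub>j - w\<^sub>i) = (c z\<^sub>i + d) / D * (c + (c z\<^sub>i + d) / (z\<^sub>j - z\<^sub>i))\<close>.
  At a fixed vertex \<open>i\<close> the transformed sum is therefore a linear combination of the two vanishing
  sums \<open>\<Sum>\<^sub>j q\<^sub>i\<^sub>j\<close> and \<open>\<Sum>\<^sub>j q\<^sub>i\<^sub>j / (z\<^sub>j - z\<^sub>i)\<close>.
\<close>

lemma moebius_diff:
  fixes a b c d x y :: complex
  assumes "c * x + d \<noteq> 0" "c * y + d \<noteq> 0"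
  shows "(a * y + b) / (c * y + d) - (a * x + b) / (c * x + d) =
         (a * d - b * c) * (y - x) / ((c * x + d) * (c * y + d))"
  using assms by (simp add: divide_simps) (simp add: algebra_simps)

text \<open>Substituting \<open>c * y + d = c * (y - x) + (c * x + d)\<close> confines
  \<open>y\<close> to the single term \<open>1 / (y - x)\<close>. If
  \<open>a * d - b * c = 0\<close>, both sides are 0, as division by 0 gives 0.\<close>

lemma inverse_moebius_diff:
  fixes a b c d x y :: complex
  assumes "c * x + d \<noteq> 0" "c * y + d \<noteq> 0" "x \<noteq> y"
  shows "1 / ((a * y + b) / (c * y + d) - (a * x + b) / (c * x + d)) =
         (c * x + d) / (a * d - b * c) * (c + (c * x + d) / (y - x))"
proof -
  have "c + (c * x + d) / (y - x) = (c * y + d) / (y - x)"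
    using assms(3) by (simp add: field_simps)
  then show ?thesis
    by (simp add: moebius_diff[OF assms(1,2)])
qed

lemma edge_vertices:
  assumes "{i, j} \<in> edges K"
  shows "i \<in> vertices K" "j \<in> vertices K"
  using assms by (auto simp: edges_def vertices_def)

theorem theorem4p2:
  fixes K :: "'v set set"
    and P :: "('v \<times> 'v \<times> 'v) set"
    and z :: "'v \<Rightarrow> complex"
    and q :: "'v set \<Rightarrow> complex"
    and \<Phi> :: "complex option \<Rightarrow> complex option"
  assumes "triangular_mesh K P"
    and "realization K z"
    and "discrete_holomorphic_quadratic_differential K z q"
    and "moebius_transformation \<Phi>"
    and "\<forall>i\<in>vertices K. \<Phi> (Some (z i)) \<noteq> None"
  shows "discrete_holomorphic_quadratic_differential K (\<lambda>i. the (\<Phi> (Some (z i)))) q"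
proof -
  obtain a b c d where D: "a * d - b * c \<noteq> 0" and \<Phi>: "\<Phi> = moebius a b c d"
    using assms(4) by (auto simp: moebius_transformation_def)
  define w where "w = (\<lambda>i. the (\<Phi> (Some (z i))))"
  \<comment> \<open>The value \<open>None\<close> at a finite point occurs only at the pole.\<close>
  have denom: "c * z i + d \<noteq> 0" if "i \<in> vertices K" for i
    using assms(5) that by (auto simp: \<Phi> moebius_def split: if_splits)
  have w: "w i = (a * z i + b) / (c * z i + d)" if "i \<in> vertices K" for i
    using denom[OF that] by (simp add: w_def \<Phi> moebius_def)
  have z_neq: "z i \<noteq> z j" if "{i, j} \<in> edges K" for i j
    using assms(3) that by (auto simp: discrete_holomorphic_quadratic_differential_def)
  have w_neq: "w i \<noteq> w j" if e: "{i, j} \<in> edges K" for i j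
  proof -
    \<comment> \<open>The difference is the determinant times \<open>z j - z i\<close>, over nonzero
      denominators.\<close>
    have "w j - w i \<noteq> 0"
      using z_neq[OF e] D denom edge_vertices[OF e]
      by (simp add: w moebius_diff)
    then show ?thesis by auto
  qed
  have w_sum: "(\<Sum>j\<in>neighbours K i. q {i, j} / (w j - w i)) = 0"
    if i: "i \<in> interior_vertices K" for i
  proof -
    \<comment> \<open>\<open>m\<close> is independent of \<open>j\<close>, so it factors out of the
      sum.\<close>
    define m where "m = c * z i + d"
    have "q {i, j} / (w j - w i) =
        m / (a * d - b * c) * (c * q {i, j} + m * (q {i, j} / (z j - z i)))"
      if "j \<in> neighbours K i" for j
    proof -
      have e: "{i, j} \<in> edges K" using that by (simp add: neighbours_def)
      have "1 / (w j - w i) = m / (a * d - b * c) * (c + m / (z j - z i))"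
        unfolding w[OF edge_vertices(1)[OF e]] w[OF edge_vertices(2)[OF e]] m_def
        by (intro inverse_moebius_diff denom edge_vertices[OF e] z_neq[OF e])
      then have "q {i, j} * (1 / (w j - w i)) =
          q {i, j} * (m / (a * d - b * c) * (c + m / (z j - z i)))"
        by simp
      then show ?thesis by (simp add: distrib_left add_divide_distrib ac_simps)
    qed
    \<comment> \<open>Linearity also covers infinite index sets, where every sum is 0 by
      convention.\<close>
    then have "(\<Sum>j\<in>neighbours K i. q {i, j} / (w j - w i)) =
        m / (a * d - b * c) * (c * (\<Sum>j\<in>neighbours K i. q {i, j}) +
          m * (\<Sum>j\<in>neighbours K i. q {i, j} / (z j - z i)))"
      by (simp only: sum.distrib sum_distrib_left[symmetric] cong: sum.cong)
    then show ?thesis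
      using assms(3) i by (simp add: discrete_holomorphic_quadratic_differential_def)
  qed
  \<comment> \<open>The condition on \<open>Re (q e)\<close> does not involve \<open>z\<close> and
    carries over unchanged.\<close>
  show ?thesis
    using assms(3) w_neq w_sum
    unfolding discrete_holomorphic_quadratic_differential_def w_def by blast
qed

end
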